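(* Let $N\ge 2$, $p_1\in[0,1]$, $p_2=\frac12$, and $0\le a<b$. Let the pair $(J,\sigma)$ be drawn from the ensemble $\mathcal{G}_N(p_1,p_2)$ and let $\mu_1,\dots,\mu_N$ be i.i.d. random variables, uniformly distributed on $[a,b]$ and independent of $(J,\sigma)$. Let $\mathcal{H}(\sigma)=-\frac12\sum_{i=1}^N\sum_{j=1}^N J_{ij}\sigma_i\sigma_j$ and let $H(\sigma,\mu)\in\mathbb{R}^{N\times N}$ be the Hessian matrix $$H_{ij}(\sigma,\mu)=\begin{cases}\sum_{k=1}^N J_{ik}\sigma_i\sigma_k+2\mu_i, & i=j,\\ -J_{ij}\sigma_i\sigma_j,& i\ne j.\end{cases}$$ Let $\lambda$ be an eigenvalue drawn uniformly at random from the spectrum of $H(\sigma,\mu)$. Then for every $h$ with $\mathbb{P}(\mathcal{H}(\sigma)=h)>0$, $$\mathbb{E}[\lambda\mid \mathcal{H}(\sigma)=h]=-\frac{2}{N}h+(a+b).$$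
   Context: The ensemble $\mathcal{G}_N(p_1,p_2)$: $J\in\mathbb{R}^{N\times N}$ is a random symmetric matrix with zero diagonal whose entries $J_{ij}$, $i<j$, are independent with $J_{ij}=-1$ with probability $p_1$ and $J_{ij}=0$ with probability $1-p_1$; $\sigma=(\sigma_1,\dots,\sigma_N)$ has independent entries, independent of $J$, with $\sigma_i=+1$ with probability $p_2$ and $\sigma_i=-1$ with probability $1-p_2$. "Drawn uniformly from the spectrum" means: conditionally on $(J,\sigma,\mu)$, $\lambda$ equals each of the $N$ eigenvalues (listed with multiplicity) of the symmetric matrix $H(\sigma,\mu)$ with probability $1/N$. *)

theory Defs
  imports "HOL-Probability.Probability" "Jordan_Normal_Form.Char_Poly"
begin

(* Only the vec_index reading of "$" is wanted below. *)
unbundle no vec_syntax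

text \<open>
  Vectors and matrices whose size is a natural number come without a measurable
  structure, so random ones are turned into families of real random variables,
  with values in finite products of Borel spaces.
\<close>

definition entries :: "nat \<Rightarrow> real mat \<Rightarrow> nat \<times> nat \<Rightarrow> real" where
  "entries N A = (\<lambda>ij\<in>{..<N} \<times> {..<N}. A $$ ij)"

definition coords :: "nat \<Rightarrow> real vec \<Rightarrow> nat \<Rightarrow> real" where
  "coords N v = (\<lambda>i\<in>{..<N}. v $ i)"

abbreviation entries_space :: "nat \<Rightarrow> (nat \<times> nat \<Rightarrow> real) measure" where
  "entries_space N \<equiv> (\<Pi>\<^sub>M ij\<in>{..<N} \<times> {..<N}. borel)"

abbreviation coords_space :: "nat \<Rightarrow> (nat \<Rightarrow> real) measure" where
  "coords_space N \<equiv> (\<Pi>\<^sub>M i\<in>{..<N}. borel)"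

text \<open>
  The library's \<open>indep_var\<close> requires both random variables to have the same type;
  this is independence of the generated sigma-algebras for variables of different types.
\<close>

definition (in prob_space) independent ::
    "'b measure \<Rightarrow> ('a \<Rightarrow> 'b) \<Rightarrow> 'c measure \<Rightarrow> ('a \<Rightarrow> 'c) \<Rightarrow> bool" where
  "independent S X T Y \<longleftrightarrow>
     random_variable S X \<and> random_variable T Y \<and>
     indep_set {X -` A \<inter> space M | A. A \<in> sets S} {Y -` B \<inter> space M | B. B \<in> sets T}"

locale spin_ensemble = prob_space M for M :: "'w measure" +
  fixes N :: nat and p1 p2 :: real
    and J :: "'w \<Rightarrow> real mat" and \<sigma> :: "'w \<Rightarrow> real vec"
  assumes J_carrier: "w \<in> space M \<Longrightarrow> J w \<in> carrier_mat N N"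
    and J_symmetric: "w \<in> space M \<Longrightarrow> transpose_mat (J w) = J w"
    and J_diag: "w \<in> space M \<Longrightarrow> i < N \<Longrightarrow> J w $$ (i, i) = 0"
    and J_indep: "indep_vars (\<lambda>_. borel) (\<lambda>ij w. J w $$ ij) {(i, j). i < j \<and> j < N}"
    and J_minus: "i < j \<Longrightarrow> j < N \<Longrightarrow> prob {w \<in> space M. J w $$ (i, j) = - 1} = p1"
    and J_zero: "i < j \<Longrightarrow> j < N \<Longrightarrow> prob {w \<in> space M. J w $$ (i, j) = 0} = 1 - p1"
    and \<sigma>_carrier: "w \<in> space M \<Longrightarrow> \<sigma> w \<in> carrier_vec N"
    and \<sigma>_indep: "indep_vars (\<lambda>_. borel) (\<lambda>i w. \<sigma> w $ i) {..<N}"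
    and \<sigma>_plus: "i < N \<Longrightarrow> prob {w \<in> space M. \<sigma> w $ i = 1} = p2"
    and \<sigma>_minus: "i < N \<Longrightarrow> prob {w \<in> space M. \<sigma> w $ i = - 1} = 1 - p2"
    and J_\<sigma>_indep: "independent (entries_space N) (\<lambda>w. entries N (J w))
                                (coords_space N) (\<lambda>w. coords N (\<sigma> w))"

definition energy :: "nat \<Rightarrow> real mat \<Rightarrow> real vec \<Rightarrow> real" where
  "energy N J s = - (1 / 2) * (\<Sum>i<N. \<Sum>j<N. J $$ (i, j) * s $ i * s $ j)"

definition hessian :: "nat \<Rightarrow> real mat \<Rightarrow> real vec \<Rightarrow> real vec \<Rightarrow> real mat" where
  "hessian N J s m = mat N N (\<lambda>(i, j).
     if i = j then (\<Sum>k<N. J $$ (i, k) * s $ i * s $ k) + 2 * m $ i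
     else - J $$ (i, j) * s $ i * s $ j)"

text \<open>
  The real eigenvalues, repeated according to algebraic multiplicity. For a real
  symmetric \<open>N \<times> N\<close> matrix there are exactly \<open>N\<close> of them, and algebraic and
  geometric multiplicities agree.
\<close>

definition eigenvalues :: "real mat \<Rightarrow> real multiset" where
  "eigenvalues A = proots (char_poly A)"

text \<open>
  Given \<open>F\<close>, each listed eigenvalue of the \<open>F\<close>-measurable random \<open>N \<times> N\<close> matrix \<open>A\<close>
  is picked with probability \<open>1 / N\<close>. Since \<open>A\<close> may have a continuous law, this is
  expressed by the conditional law of \<open>lam\<close> on all Borel sets.
\<close>

definition drawn_from_spectrum ::
    "'w measure \<Rightarrow> 'w measure \<Rightarrow> nat \<Rightarrow> ('w \<Rightarrow> real mat) \<Rightarrow> ('w \<Rightarrow> real) \<Rightarrow> bool" where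
  "drawn_from_spectrum M F N A lam \<longleftrightarrow>
     lam \<in> borel_measurable M \<and>
     (\<forall>S\<in>sets borel. AE w in M.
        real_cond_exp M F (indicator (lam -` S)) w
          = real (size {#e \<in># eigenvalues (A w). e \<in> S#}) / real N)"

text \<open>The sigma-algebra generated by a random triple \<open>(J, \<sigma>, \<mu>)\<close>.\<close>

definition generated_algebra ::
    "'w measure \<Rightarrow> nat \<Rightarrow> ('w \<Rightarrow> real mat) \<Rightarrow> ('w \<Rightarrow> real vec) \<Rightarrow> ('w \<Rightarrow> real vec) \<Rightarrow> 'w measure"
  where
  "generated_algebra M N J \<sigma> \<mu> =
     vimage_algebra (space M)
       (\<lambda>w. (entries N (J w), coords N (\<sigma> w), coords N (\<mu> w)))
       (entries_space N \<Otimes>\<^sub>M coords_space N \<Otimes>\<^sub>M coords_space N)"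

end

theory Submission
  imports Defs "Jordan_Normal_Form.Schur_Decomposition"
begin

text \<open>
  Given \<open>(J, \<sigma>, \<mu>)\<close>, the mean of \<open>lam\<close> is the normalized trace of the Hessian, which equals
  \<open>- 2 / N\<close> times the energy plus \<open>2 / N\<close> times the sum of the \<open>\<mu>\<^sub>i\<close>. The event that the
  energy is \<open>h\<close> depends on \<open>(J, \<sigma>)\<close> only, so each \<open>\<mu>\<^sub>i\<close> still has mean \<open>(a + b) / 2\<close> on it.
  Almost surely the Hessian entries are bounded, hence so is \<open>lam\<close>, which makes it integrable.
\<close>

section \<open>Spectrum, trace and eigenvalue bounds of real matrices\<close>

text \<open>The Hermitian form \<open>q\<close> of \<open>A\<close> at an eigenvector
  \<open>v\<close> equals its own conjugate, because exchanging the two summation indices leaves a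
  symmetric real matrix unchanged. It also equals \<open>a\<close> times the squared norm
  \<open>s\<close>, a nonzero real number, so \<open>a\<close> is fixed by conjugation.\<close>

lemma eigenvalue_of_real_symmetric_real:
  fixes A :: "real mat"
  assumes A: "A \<in> carrier_mat n n" and sym: "transpose_mat A = A"
    and ev: "eigenvalue (map_mat complex_of_real A) a"
  shows "a \<in> \<real>"
proof -
  obtain v where v: "v \<in> carrier_vec n" "v \<noteq> 0\<^sub>v n"
    and Av: "map_mat complex_of_real A *\<^sub>v v = a \<cdot>\<^sub>v v"
    using ev A unfolding eigenvalue_def eigenvector_def by auto
  have A_sym: "A $$ (i, j) = A $$ (j, i)" if "i < n" "j < n" for i j
    using arg_cong[OF sym, of "\<lambda>B. B $$ (j, i)"] A that by auto
  have row: "(\<Sum>j<n. of_real (A $$ (i, j)) * v $ j) = a * v $ i" if "i < n" for i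
    using arg_cong[OF Av, of "\<lambda>u. u $ i"] A v that
    by (simp add: scalar_prod_def lessThan_atLeast0)
  define q where "q = (\<Sum>i<n. \<Sum>j<n. of_real (A $$ (i, j)) * v $ j * cnj (v $ i))"
  define s where "s = (\<Sum>i<n. v $ i * cnj (v $ i))"
  have "cnj q = (\<Sum>i<n. \<Sum>j<n. of_real (A $$ (j, i)) * v $ i * cnj (v $ j))"
    by (auto simp: q_def A_sym ac_simps intro!: sum.cong)
  also have "\<dots> = q"
    unfolding q_def by (rule sum.swap)
  finally have "cnj q = q" .
  moreover have "q = (\<Sum>i<n. (\<Sum>j<n. of_real (A $$ (i, j)) * v $ j) * cnj (v $ i))"
    by (simp add: q_def sum_distrib_right)
  then have "q = a * s"
    by (simp add: s_def row sum_distrib_left mult.assoc)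
  moreover have s_eq: "s = of_real (\<Sum>i<n. (cmod (v $ i))\<^sup>2)"
    by (simp add: s_def complex_norm_square flip: of_real_power)
  then have "cnj s = s"
    by simp
  moreover have "s \<noteq> 0"
  proof
    assume "s = 0"
    then have "(\<Sum>i<n. (cmod (v $ i))\<^sup>2) = 0"
      unfolding s_eq by (simp only: of_real_eq_0_iff)
    then have "\<forall>i<n. v $ i = 0"
      by (subst (asm) sum_nonneg_eq_0_iff) auto
    with v show False
      by (auto intro: eq_vecI)
  qed
  ultimately have "cnj a = a"
    by (metis complex_cnj_mult mult_right_cancel)
  then show ?thesis
    by (simp add: Reals_cnj_iff)
qed

text \<open>Over the complex numbers the characteristic polynomial splits, and its roots are
  eigenvalues of the complexified matrix, hence real. The embedding of real into complex polynomials
  is injective, so the factorization descends to the reals.\<close>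

lemma char_poly_symmetric_splits:
  fixes A :: "real mat"
  assumes A: "A \<in> carrier_mat n n" and sym: "transpose_mat A = A"
  obtains es where "char_poly A = (\<Prod>e\<leftarrow>es. [:- e, 1:])" "length es = n"
proof -
  let ?B = "map_mat complex_of_real A"
  have B: "?B \<in> carrier_mat n n"
    using A by simp
  obtain as where as: "char_poly ?B = (\<Prod>a\<leftarrow>as. [:- a, 1:])" "length as = n"
    using char_poly_factorized[OF B] by blast
  have "a \<in> \<real>" if "a \<in> set as" for a
  proof (rule eigenvalue_of_real_symmetric_real[OF A sym])
    show "eigenvalue ?B a"
      using that by (auto simp: eigenvalue_root_char_poly[OF B] as poly_prod_list_zero_iff)
  qed
  then have as_eq: "as = map complex_of_real (map Re as)"
    by (auto intro!: map_idI[symmetric])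
  interpret P: map_poly_inj_comm_ring_hom complex_of_real ..
  have "map_poly complex_of_real (char_poly A) = char_poly ?B"
    by (rule of_real_hom.char_poly_hom[OF A, symmetric])
  also have "\<dots> = map_poly complex_of_real (\<Prod>e\<leftarrow>map Re as. [:- e, 1:])"
    unfolding as by (subst as_eq) (simp add: P.hom_prod_list o_def)
  finally have "char_poly A = (\<Prod>e\<leftarrow>map Re as. [:- e, 1:])"
    by (rule P.injectivity)
  with as show ?thesis
    by (intro that[of "map Re as"]) auto
qed

lemma eigenvalues_eq_mset:
  assumes "char_poly A = (\<Prod>e\<leftarrow>es. [:- e, 1:])"
  shows "eigenvalues A = mset es"
proof -
  have "proots (\<Prod>e\<leftarrow>es. [:- e, 1:]) = mset es" for es :: "real list"
  proof (induction es)
    case (Cons e es)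
    have "(\<Prod>e\<leftarrow>es. [:- e, 1:]) \<noteq> 0"
      by (auto simp: prod_list_zero_iff)
    with Cons show ?case
      by (simp add: proots_mult del: mult_pCons_left)
  qed simp
  then show ?thesis
    by (simp add: eigenvalues_def assms)
qed

lemma size_eigenvalues_symmetric:
  assumes "A \<in> carrier_mat n n" "transpose_mat A = A"
  shows "size (eigenvalues A) = n"
  using char_poly_symmetric_splits[OF assms] eigenvalues_eq_mset by (metis size_mset)

lemma sum_diag_mult_comm:
  fixes A B :: "'a :: comm_semiring_0 mat"
  assumes A: "A \<in> carrier_mat n n" and B: "B \<in> carrier_mat n n"
  shows "(\<Sum>i<n. (A * B) $$ (i, i)) = (\<Sum>i<n. (B * A) $$ (i, i))"
proof -
  have "(\<Sum>i<n. (A * B) $$ (i, i)) = (\<Sum>i<n. \<Sum>j<n. A $$ (i, j) * B $$ (j, i))"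
    using A B by (auto simp: scalar_prod_def lessThan_atLeast0)
  also have "\<dots> = (\<Sum>i<n. \<Sum>j<n. B $$ (i, j) * A $$ (j, i))"
    by (subst sum.swap) (simp add: mult.commute)
  also have "\<dots> = (\<Sum>i<n. (B * A) $$ (i, i))"
    using A B by (auto simp: scalar_prod_def lessThan_atLeast0)
  finally show ?thesis .
qed

text \<open>A Schur decomposition makes \<open>A\<close> similar to a matrix \<open>B\<close> whose
  diagonal is the list \<open>es\<close> of roots. The trace is invariant under similarity by
  \<open>sum_diag_mult_comm\<close>.\<close>

lemma sum_eigenvalues_symmetric:
  assumes A: "A \<in> carrier_mat n n" and sym: "transpose_mat A = A"
  shows "(\<Sum>e\<in>#eigenvalues A. e) = (\<Sum>i<n. A $$ (i, i))"
proof -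
  obtain es where es: "char_poly A = (\<Prod>e\<leftarrow>es. [:- e, 1:])" "length es = n"
    using char_poly_symmetric_splits[OF A sym] .
  obtain B P Q where sd: "schur_decomposition A es = (B, P, Q)"
    by (cases "schur_decomposition A es") auto
  from schur_decomposition[OF A es(1) sd]
  have sim: "similar_mat_wit A B P Q" and diag: "diag_mat B = es"
    by auto
  note w = similar_mat_witD2[OF A sim]
  have "(\<Sum>i<n. A $$ (i, i)) = (\<Sum>i<n. (P * B * Q) $$ (i, i))"
    using w(3) by simp
  also have "\<dots> = (\<Sum>i<n. (Q * (P * B)) $$ (i, i))"
    using w by (intro sum_diag_mult_comm) auto
  also have "Q * (P * B) = B"
    using w by (simp flip: assoc_mult_mat)
  also have "(\<Sum>i<n. B $$ (i, i)) = sum_list es"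
    using w(5) diag[symmetric] by (simp add: diag_mat_def sum_list_sum_nth lessThan_atLeast0)
  finally show ?thesis
    by (simp add: eigenvalues_eq_mset[OF es(1)] sum_mset_sum_list)
qed

text \<open>The eigenvector equation is read in a row \<open>i\<close> where the modulus of
  \<open>v $ i\<close> is maximal. Each of the \<open>n\<close> summands of that row is at most
  \<open>C\<close> times this modulus, which is positive and cancels.\<close>

lemma eigenvalue_bound:
  fixes A :: "real mat"
  assumes A: "A \<in> carrier_mat n n"
    and bound: "\<And>i j. i < n \<Longrightarrow> j < n \<Longrightarrow> \<bar>A $$ (i, j)\<bar> \<le> C"
    and e: "e \<in># eigenvalues A"
  shows "\<bar>e\<bar> \<le> real n * C"
proof -
  have "char_poly A \<noteq> 0"
    using degree_monic_char_poly[OF A] by auto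
  with e have "eigenvalue A e"
    by (simp add: eigenvalues_def eigenvalue_root_char_poly[OF A])
  then obtain v where v: "v \<in> carrier_vec n" "v \<noteq> 0\<^sub>v n" and Av: "A *\<^sub>v v = e \<cdot>\<^sub>v v"
    using A unfolding eigenvalue_def eigenvector_def by auto
  have row: "(\<Sum>j<n. A $$ (i, j) * v $ j) = e * v $ i" if "i < n" for i
    using arg_cong[OF Av, of "\<lambda>u. u $ i"] A v that
    by (simp add: scalar_prod_def lessThan_atLeast0)
  obtain k where k: "k < n" "v $ k \<noteq> 0"
    using v by (metis carrier_vecD eq_vecI index_zero_vec)
  have "Max ((\<lambda>i. \<bar>v $ i\<bar>) ` {..<n}) \<in> (\<lambda>i. \<bar>v $ i\<bar>) ` {..<n}"
    using k by (intro Max_in) auto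
  then obtain i where i: "i < n" and i_max: "Max ((\<lambda>i. \<bar>v $ i\<bar>) ` {..<n}) = \<bar>v $ i\<bar>"
    by auto
  have imax: "\<bar>v $ j\<bar> \<le> \<bar>v $ i\<bar>" if "j < n" for j
    unfolding i_max[symmetric] using that by (intro Max_ge) auto
  have pos: "\<bar>v $ i\<bar> > 0"
    using imax[OF k(1)] k by auto
  have "\<bar>e\<bar> * \<bar>v $ i\<bar> = \<bar>\<Sum>j<n. A $$ (i, j) * v $ j\<bar>"
    by (simp add: row[OF i] abs_mult)
  also have "\<dots> \<le> (\<Sum>j<n. \<bar>A $$ (i, j)\<bar> * \<bar>v $ j\<bar>)"
    by (rule order_trans[OF sum_abs]) (simp add: abs_mult)
  also have "\<dots> \<le> (\<Sum>j<n. C * \<bar>v $ i\<bar>)"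
    using bound[OF i] imax order_trans[OF abs_ge_zero bound[OF i i]]
    by (intro sum_mono mult_mono) auto
  also have "\<dots> = (real n * C) * \<bar>v $ i\<bar>"
    by simp
  finally show ?thesis
    using pos by simp
qed

section \<open>Conditional mean of a value drawn from the spectrum\<close>

text \<open>Exchanging the order of summation turns weighted counts of eigenvalues in level sets
  into a sum of a step function over the eigenvalues.\<close>

lemma sum_size_filter_mset:
  "(\<Sum>k\<in>I. c k * real (size {#e \<in># X. e \<in> S k#})) = (\<Sum>e\<in>#X. \<Sum>k\<in>I. c k * indicator (S k) e)"
proof (induction X)
  case (add x X)
  have "c k * real (size {#e \<in># add_mset x X. e \<in> S k#})
      = c k * indicator (S k) x + c k * real (size {#e \<in># X. e \<in> S k#})" for k
    by (simp add: indicator_def algebra_simps)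
  with add show ?case
    by (simp add: sum.distrib)
qed simp

lemma abs_sum_mset_diff_le:
  fixes f g :: "'a \<Rightarrow> real"
  assumes "\<And>e. e \<in># X \<Longrightarrow> \<bar>f e - g e\<bar> \<le> d"
  shows "\<bar>(\<Sum>e\<in>#X. f e) - (\<Sum>e\<in>#X. g e)\<bar> \<le> real (size X) * d"
  using assms
proof (induction X)
  case (add x X)
  have "\<bar>f x - g x\<bar> \<le> d" "\<bar>(\<Sum>e\<in>#X. f e) - (\<Sum>e\<in>#X. g e)\<bar> \<le> real (size X) * d"
    using add by auto
  then show ?case
    by (simp add: algebra_simps)
qed simp

text \<open>For the Borel set from \<open>- K\<close> to \<open>K\<close> the prescribed conditional
  probability is almost surely \<open>N / N = 1\<close>, since all listed eigenvalues lie in it.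
  Integrating gives probability 1. The bound serves to make \<open>lam\<close> integrable.\<close>

lemma drawn_from_spectrum_bounded:
  assumes M: "prob_space M" and sub: "subalgebra M F" and N: "N > 0"
    and drawn: "drawn_from_spectrum M F N A lam"
    and size: "\<And>w. w \<in> space M \<Longrightarrow> size (eigenvalues (A w)) = N"
    and bound: "AE w in M. \<forall>e\<in>#eigenvalues (A w). \<bar>e\<bar> \<le> K"
  shows "AE w in M. \<bar>lam w\<bar> \<le> K"
proof -
  interpret prob_space M by fact
  interpret finite_measure_subalgebra M F
    by unfold_locales (fact sub)
  have [measurable]: "lam \<in> borel_measurable M"
    using drawn by (simp add: drawn_from_spectrum_def)
  let ?S = "{- K..K}"
  have set_eq: "space M \<inter> lam -` ?S = {w \<in> space M. \<bar>lam w\<bar> \<le> K}"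
    by auto
  \<comment> \<open>The preimage under \<open>lam\<close> may contain points outside
    \<open>space M\<close>, so measurability of its indicator is a statement about its intersection
    with \<open>space M\<close>.\<close>
  have [measurable]: "(indicator (lam -` ?S) :: 'a \<Rightarrow> real) \<in> borel_measurable M"
    unfolding borel_measurable_indicator_iff set_eq by (simp add: Int_commute[of _ "space M"] set_eq)
  have "prob {w \<in> space M. \<bar>lam w\<bar> \<le> K} = (\<integral>w. indicator (lam -` ?S) w \<partial>M)"
    by (simp add: set_eq Int_commute)
  also have "\<dots> = (\<integral>w. real_cond_exp M F (indicator (lam -` ?S)) w \<partial>M)"
    by (rule real_cond_exp_int(2)[symmetric], rule integrable_const_bound[of _ 1]) (auto simp: indicator_def)
  also have "\<dots> = (\<integral>w. 1 \<partial>M)"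
  proof (rule integral_cong_AE)
    have "AE w in M. real_cond_exp M F (indicator (lam -` ?S)) w
        = real (size {#e \<in># eigenvalues (A w). e \<in> ?S#}) / real N"
      using drawn by (simp only: drawn_from_spectrum_def) (rule bspec, auto)
    then show "AE w in M. real_cond_exp M F (indicator (lam -` ?S)) w = 1"
      using bound AE_space
    proof eventually_elim
      case (elim w)
      have "{#e \<in># eigenvalues (A w). e \<in> ?S#} = eigenvalues (A w)"
        using elim by (auto simp: filter_mset_eq_conv abs_le_iff minus_le_iff)
      with elim N size[of w] show ?case
        by simp
    qed
  qed auto
  finally have "prob {w \<in> space M. \<bar>lam w\<bar> \<le> K} = 1"
    by (simp add: prob_space)
  then show ?thesis
    by (subst (asm) prob_Collect_eq_1) auto
qed

text \<open>
  The law of \<open>lam\<close> is known only on Borel sets, so \<open>lam\<close> is rounded down to multiples of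
  \<open>1 / n\<close>; the resulting error of \<open>2 / n\<close> vanishes as \<open>n\<close> grows.
\<close>

lemma real_cond_exp_drawn_from_spectrum:
  assumes M: "prob_space M" and sub: "subalgebra M F" and N: "N > 0"
    and drawn: "drawn_from_spectrum M F N A lam"
    and size: "\<And>w. w \<in> space M \<Longrightarrow> size (eigenvalues (A w)) = N"
    and bound: "AE w in M. \<forall>e\<in>#eigenvalues (A w). \<bar>e\<bar> \<le> K"
  shows "AE w in M. real_cond_exp M F lam w = (\<Sum>e\<in>#eigenvalues (A w). e) / real N"
proof -
  interpret prob_space M by fact
  interpret finite_measure_subalgebra M F
    by unfold_locales (fact sub)
  have lam_meas [measurable]: "lam \<in> borel_measurable M"
    using drawn by (simp add: drawn_from_spectrum_def)
  have lam_bound: "AE w in M. \<bar>lam w\<bar> \<le> K"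
    by (rule drawn_from_spectrum_bounded[OF assms])
  have lam_int [simp]: "integrable M lam"
    by (rule integrable_const_bound[of _ K]) (use lam_bound in auto)
  have approx: "AE w in M.
      real (Suc n) * \<bar>real_cond_exp M F lam w - (\<Sum>e\<in>#eigenvalues (A w). e) / real N\<bar> \<le> 2" for n
  proof -
    define m where "m = real (Suc n)"
    have m: "m > 0" by (simp add: m_def)
    \<comment> \<open>\<open>I\<close> contains the rounded value of \<open>m * x\<close> for every
      \<open>x\<close> of modulus at most \<open>K\<close>. Thus \<open>r\<close> is a finite sum in
      which exactly one indicator survives at such an \<open>x\<close>, and linearity of conditional
      expectation suffices.\<close>
    define I where "I = {\<lfloor>m * - K\<rfloor>..\<lfloor>m * K\<rfloor>}"
    define S where "S k = {x. \<lfloor>m * x\<rfloor> = k}" for k :: int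
    define r where "r x = (\<Sum>k\<in>I. (of_int k / m) * indicator (S k) x)" for x :: real
    have S [measurable]: "S k \<in> sets borel" for k
      unfolding S_def by measurable
    have r: "\<bar>r x - x\<bar> \<le> 1 / m" if "\<bar>x\<bar> \<le> K" for x
    proof -
      have "m * - K \<le> m * x" "m * x \<le> m * K"
        using that m by (auto simp only: abs_le_iff intro!: mult_left_mono)
      then have "\<lfloor>m * x\<rfloor> \<in> I"
        unfolding I_def by (simp only: atLeastAtMost_iff floor_mono)
      moreover have "r x = (\<Sum>k\<in>I. if k = \<lfloor>m * x\<rfloor> then of_int k / m else 0)"
        unfolding r_def S_def by (intro sum.cong) auto
      ultimately have "r x = of_int \<lfloor>m * x\<rfloor> / m"
        by (simp add: I_def)
      then have "r x - x = (of_int \<lfloor>m * x\<rfloor> - m * x) / m"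
        using m by (simp add: field_simps)
      moreover have "\<bar>of_int \<lfloor>m * x\<rfloor> - m * x\<bar> \<le> 1"
        by linarith
      ultimately show ?thesis
        using m by (simp add: abs_divide divide_right_mono)
    qed
    have ind_int: "integrable M (indicator (lam -` S k) :: 'a \<Rightarrow> real)" for k
    proof -
      have "(\<lambda>w. indicator (S k) (lam w) :: real) \<in> borel_measurable M"
        by measurable
      then show ?thesis
        by (intro integrable_const_bound[of _ 1]) (auto simp: indicator_def vimage_def)
    qed
    have r_eq: "r (lam w) = (\<Sum>k\<in>I. (of_int k / m) * indicator (lam -` S k) w)" for w
      by (simp add: r_def indicator_def)
    have r_int: "integrable M (\<lambda>w. r (lam w))"
      unfolding r_eq by (intro Bochner_Integration.integrable_sum integrable_mult_right ind_int)
    have "AE w in M. real_cond_exp M F (\<lambda>w. r (lam w)) w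
        = (\<Sum>k\<in>I. real_cond_exp M F (\<lambda>w. (of_int k / m) * indicator (lam -` S k) w) w)"
      unfolding r_eq by (intro real_cond_exp_sum integrable_mult_right ind_int)
    \<comment> \<open>The integers \<open>k\<close> are countable, so a single null set serves all
      of them.\<close>
    moreover have "AE w in M. \<forall>k. real_cond_exp M F (\<lambda>w. (of_int k / m) * indicator (lam -` S k) w) w
        = (of_int k / m) * real_cond_exp M F (indicator (lam -` S k)) w"
      unfolding AE_all_countable by (intro allI real_cond_exp_cmult ind_int)
    moreover have "AE w in M. \<forall>k. real_cond_exp M F (indicator (lam -` S k)) w
        = real (size {#e \<in># eigenvalues (A w). e \<in> S k#}) / real N"
      unfolding AE_all_countable using drawn S by (simp only: drawn_from_spectrum_def) blast
    moreover have "AE w in M. real_cond_exp M F (\<lambda>w. lam w - r (lam w)) w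
        = real_cond_exp M F lam w - real_cond_exp M F (\<lambda>w. r (lam w)) w"
      by (intro real_cond_exp_diff lam_int r_int)
    moreover have diff: "AE w in M. lam w - r (lam w) \<le> 1 / m" "AE w in M. - (1 / m) \<le> lam w - r (lam w)"
      using lam_bound by (eventually_elim, use r in \<open>force simp: abs_le_iff\<close>)+
    moreover have "AE w in M. real_cond_exp M F (\<lambda>w. lam w - r (lam w)) w \<le> 1 / m"
      by (intro real_cond_exp_le_c Bochner_Integration.integrable_diff lam_int r_int diff)
    moreover have "AE w in M. - (1 / m) \<le> real_cond_exp M F (\<lambda>w. lam w - r (lam w)) w"
      by (intro real_cond_exp_ge_c Bochner_Integration.integrable_diff lam_int r_int diff)
    ultimately show ?thesis
      using bound AE_space
    proof eventually_elim
      case (elim w)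
      let ?E = "eigenvalues (A w)"
      have "real_cond_exp M F (\<lambda>w. r (lam w)) w
          = (\<Sum>k\<in>I. (of_int k / m) * real (size {#e \<in># ?E. e \<in> S k#})) / real N"
        using elim by (simp add: sum_divide_distrib)
      also have "\<dots> = (\<Sum>e\<in>#?E. r e) / real N"
        unfolding sum_size_filter_mset r_def ..
      finally have rce: "real_cond_exp M F (\<lambda>w. r (lam w)) w = (\<Sum>e\<in>#?E. r e) / real N" .
      have "\<bar>(\<Sum>e\<in>#?E. r e) - (\<Sum>e\<in>#?E. e)\<bar> \<le> real N * (1 / m)"
        using abs_sum_mset_diff_le[of ?E r "\<lambda>e. e" "1 / m"] r elim size[of w] by auto
      then have "\<bar>(\<Sum>e\<in>#?E. r e) / real N - (\<Sum>e\<in>#?E. e) / real N\<bar> \<le> 1 / m"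
        using N by (simp add: diff_divide_distrib[symmetric] abs_divide divide_le_eq mult.commute)
      \<comment> \<open>One \<open>1 / m\<close> comes from rounding \<open>lam\<close> under the
        conditional expectation, the other from rounding the eigenvalues in their mean.\<close>
      then have "\<bar>real_cond_exp M F lam w - (\<Sum>e\<in>#?E. e) / real N\<bar> \<le> 2 / m"
        using elim rce by (simp add: abs_le_iff)
      then show ?case
        using m unfolding m_def[symmetric] by (simp add: field_simps)
    qed
  qed
  \<comment> \<open>Outside one null set, every positive integer multiple of the difference is at
    most 2, so the difference is 0 by the Archimedean property.\<close>
  have "AE w in M. \<forall>n. real (Suc n) * \<bar>real_cond_exp M F lam w - (\<Sum>e\<in>#eigenvalues (A w). e) / real N\<bar> \<le> 2"
    unfolding AE_all_countable using approx by auto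
  then show ?thesis
  proof eventually_elim
    case (elim w)
    have "real n * \<bar>real_cond_exp M F lam w - (\<Sum>e\<in>#eigenvalues (A w). e) / real N\<bar> \<le> 2"
      if "n > 0" for n
      using elim[rule_format, of "n - 1"] that by simp
    then show ?case
      using real_archimedian_rdiv_eq_0[of "\<bar>real_cond_exp M F lam w - (\<Sum>e\<in>#eigenvalues (A w). e) / real N\<bar>" 2]
      by simp
  qed
qed

section \<open>Symmetry, trace and size of the Hessian\<close>

lemma hessian_carrier: "hessian N A s m \<in> carrier_mat N N"
  by (simp add: hessian_def)

lemma transpose_hessian:
  assumes "A \<in> carrier_mat N N" "transpose_mat A = A"
  shows "transpose_mat (hessian N A s m) = hessian N A s m"
proof -
  have "A $$ (i, j) = A $$ (j, i)" if "i < N" "j < N" for i j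
    using arg_cong[OF assms(2), of "\<lambda>B. B $$ (j, i)"] assms(1) that by auto
  then show ?thesis
    by (intro eq_matI) (auto simp: hessian_def)
qed

text \<open>The couplings on the diagonal add up to the full double sum in \<open>energy\<close>,
  whose prefactor \<open>- (1 / 2)\<close> produces the \<open>- 2\<close>. The trace thus depends
  on \<open>A\<close> and \<open>s\<close> through the energy alone.\<close>

lemma trace_hessian:
  "(\<Sum>i<N. hessian N A s m $$ (i, i)) = - 2 * energy N A s + 2 * (\<Sum>i<N. m $ i)"
  by (simp add: hessian_def energy_def sum.distrib sum_distrib_left)

text \<open>A diagonal entry has \<open>N\<close> coupling terms of modulus at most 1 and the
  summand \<open>2 * m $ i\<close>. An off-diagonal entry is a single coupling term, and
  \<open>1\<close> is below the bound since \<open>b\<close> bounds a modulus and is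
  nonnegative.\<close>

lemma hessian_entry_bound:
  assumes A: "\<And>i j. i < N \<Longrightarrow> j < N \<Longrightarrow> \<bar>A $$ (i, j)\<bar> \<le> 1"
    and s: "\<And>i. i < N \<Longrightarrow> \<bar>s $ i\<bar> \<le> 1"
    and m: "\<And>i. i < N \<Longrightarrow> \<bar>m $ i\<bar> \<le> b"
    and ij: "i < N" "j < N"
  shows "\<bar>hessian N A s m $$ (i, j)\<bar> \<le> real N + 2 * b"
proof -
  have term_bound: "\<bar>A $$ (i, k) * s $ i * s $ k\<bar> \<le> 1" if "k < N" for k
    using A[OF ij(1) that] s[OF ij(1)] s[OF that]
    by (simp add: abs_mult mult_le_one)
  have b: "0 \<le> b"
    using m[OF ij(1)] by linarith
  show ?thesis
  proof (cases "i = j")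
    case True
    have "\<bar>\<Sum>k<N. A $$ (i, k) * s $ i * s $ k\<bar> \<le> (\<Sum>k<N. 1)"
      by (rule order_trans[OF sum_abs sum_mono]) (use term_bound in auto)
    with True ij m[OF ij(1)] show ?thesis
      by (simp add: hessian_def)
  next
    case False
    with ij b term_bound[OF ij(2)] show ?thesis
      by (simp add: hessian_def)
  qed
qed

section \<open>Conditioning on an event, independence and laws of single variables\<close>

text \<open>Conditioning on \<open>E\<close> amounts to the density
  \<open>indicator E w / prob E\<close>. As \<open>prob E\<close> is positive, the extended division
  in \<open>uniform_measure\<close> is an ordinary real one.\<close>

lemma (in prob_space)
  fixes f :: "'a \<Rightarrow> real"
  assumes E: "E \<in> events" and pos: "prob E > 0" and f: "integrable M f"
  shows integrable_uniform_measure: "integrable (uniform_measure M E) f"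
    and integral_uniform_measure: "(\<integral>w. f w \<partial>uniform_measure M E) = (\<integral>w\<in>E. f w \<partial>M) / prob E"
proof -
  have um: "uniform_measure M E = density M (\<lambda>w. ennreal (indicator E w / prob E))"
    unfolding uniform_measure_def emeasure_eq_measure using pos
    by (intro density_cong) (use E in \<open>auto simp: indicator_def ennreal_1 divide_ennreal simp flip: ennreal_1\<close>)
  have [measurable]: "f \<in> borel_measurable M" "E \<in> events"
    using E f by auto
  have int: "integrable M (\<lambda>w. indicator E w * f w)"
    using integrable_mult_indicator[OF E f] by simp
  have "integrable M (\<lambda>w. (indicator E w / prob E) *\<^sub>R f w)"
    using integrable_divide[OF int, of "prob E"] by simp
  then show "integrable (uniform_measure M E) f"
    unfolding um by (subst integrable_density) auto
  have "(\<integral>w. f w \<partial>uniform_measure M E) = (\<integral>w. (indicator E w / prob E) *\<^sub>R f w \<partial>M)"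
    unfolding um by (subst integral_density) auto
  then show "(\<integral>w. f w \<partial>uniform_measure M E) = (\<integral>w\<in>E. f w \<partial>M) / prob E"
    by (simp add: set_lebesgue_integral_def)
qed

text \<open>With \<open>g\<close> the indicator of \<open>B\<close>, the set integral is the
  expectation of \<open>g (Y w) * f (X w)\<close>. Both factors are real valued and inherit
  independence from \<open>Y\<close> and \<open>X\<close>, so the product rule for
  \<open>indep_var\<close> applies even when \<open>X\<close> and \<open>Y\<close> have different
  types.\<close>

lemma (in prob_space) set_integral_independent:
  fixes f :: "'b \<Rightarrow> real"
  assumes indep: "independent S X T Y" and f: "f \<in> borel_measurable S"
    and int: "integrable M (\<lambda>w. f (X w))" and B: "B \<in> sets T"
  shows "(\<integral>w\<in>Y -` B \<inter> space M. f (X w) \<partial>M) = prob (Y -` B \<inter> space M) * expectation (\<lambda>w. f (X w))"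
proof -
  have X [measurable]: "random_variable S X" and Y [measurable]: "random_variable T Y"
    and ind: "indep_set {X -` A \<inter> space M | A. A \<in> sets S} {Y -` A \<inter> space M | A. A \<in> sets T}"
    using indep by (auto simp: independent_def)
  note f [measurable] B [measurable]
  define g :: "'c \<Rightarrow> real" where "g = indicator B"
  have g [measurable]: "g \<in> borel_measurable T"
    by (simp add: g_def)
  have "indep_set {(\<lambda>w. g (Y w)) -` A \<inter> space M | A. A \<in> sets borel}
      {(\<lambda>w. f (X w)) -` A \<inter> space M | A. A \<in> sets borel}"
    unfolding indep_sets2_eq
  proof (intro conjI ballI)
    show "{(\<lambda>w. g (Y w)) -` A \<inter> space M | A. A \<in> sets borel} \<subseteq> events"
      by (auto intro!: measurable_sets[where A = borel] measurable_sets[OF measurable_compose[OF Y g]])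
    show "{(\<lambda>w. f (X w)) -` A \<inter> space M | A. A \<in> sets borel} \<subseteq> events"
      by (auto intro!: measurable_sets[OF measurable_compose[OF X f]])
    fix a b assume "a \<in> {(\<lambda>w. g (Y w)) -` A \<inter> space M | A. A \<in> sets borel}"
      "b \<in> {(\<lambda>w. f (X w)) -` A \<inter> space M | A. A \<in> sets borel}"
    then obtain A A' where A: "A \<in> sets borel" "a = (\<lambda>w. g (Y w)) -` A \<inter> space M"
      and A': "A' \<in> sets borel" "b = (\<lambda>w. f (X w)) -` A' \<inter> space M"
      by auto
    have "a = Y -` (g -` A \<inter> space T) \<inter> space M" "b = X -` (f -` A' \<inter> space S) \<inter> space M"
      using A A' measurable_space[OF X] measurable_space[OF Y] by auto
    moreover have "g -` A \<inter> space T \<in> sets T" "f -` A' \<inter> space S \<in> sets S"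
      using A(1) A'(1) by (auto intro: measurable_sets f g)
    ultimately have "a \<in> {Y -` A \<inter> space M | A. A \<in> sets T}" "b \<in> {X -` A \<inter> space M | A. A \<in> sets S}"
      by blast+
    then have "prob (b \<inter> a) = prob b * prob a"
      using ind unfolding indep_sets2_eq by blast
    then show "prob (a \<inter> b) = prob a * prob b"
      by (simp add: Int_commute mult.commute)
  qed
  \<comment> \<open>This matches the family over the two booleans from
    \<open>indep_vars_def2\<close> with the \<open>case_bool\<close> form used by
    \<open>indep_set\<close>.\<close>
  moreover have "(\<lambda>i. {case_bool (\<lambda>w. g (Y w)) (\<lambda>w. f (X w)) i -` A \<inter> space M | A.
        A \<in> sets (case_bool borel borel i)}) =
      case_bool {(\<lambda>w. g (Y w)) -` A \<inter> space M | A. A \<in> sets borel}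
        {(\<lambda>w. f (X w)) -` A \<inter> space M | A. A \<in> sets borel}"
    by (rule ext) (simp split: bool.split)
  ultimately have "indep_var borel (\<lambda>w. g (Y w)) borel (\<lambda>w. f (X w))"
    unfolding indep_var_def indep_vars_def2 indep_set_def by (auto split: bool.split)
  moreover have "integrable M (\<lambda>w. g (Y w))"
    by (rule integrable_const_bound[of _ 1]) (auto simp: g_def indicator_def)
  ultimately have "expectation (\<lambda>w. g (Y w) * f (X w)) = expectation (\<lambda>w. g (Y w)) * expectation (\<lambda>w. f (X w))"
    using int by (rule indep_var_lebesgue_integral)
  moreover have "expectation (\<lambda>w. g (Y w)) = expectation (indicator (Y -` B \<inter> space M))"
    by (intro Bochner_Integration.integral_cong) (auto simp: g_def indicator_def)
  moreover have "expectation (\<lambda>w. g (Y w) * f (X w)) = (\<integral>w\<in>Y -` B \<inter> space M. f (X w) \<partial>M)"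
    unfolding set_lebesgue_integral_def
    by (intro Bochner_Integration.integral_cong) (auto simp: g_def indicator_def)
  ultimately show ?thesis
    by simp
qed

lemma uniform_measure_Icc_eq_density:
  fixes a b :: real
  assumes "a < b"
  shows "uniform_measure lborel {a..b} = density lborel (\<lambda>x. ennreal (indicator {a..b} x / measure lborel {a..b}))"
  unfolding uniform_measure_def using assms
  by (intro density_cong)
     (auto simp: indicator_def divide_ennreal simp flip: ennreal_1)

lemma (in prob_space) expectation_uniform:
  fixes a b :: real
  assumes "a < b" and X: "X \<in> borel_measurable M"
    and "distr M borel X = uniform_measure lborel {a..b}"
  shows "expectation X = (a + b) / 2"
proof (rule uniform_distributed_expectation)
  \<comment> \<open>\<open>distributed\<close> refers to \<open>lborel\<close>, the assumption to
    \<open>borel\<close>; both have the same measurable sets, so the image measures agree.\<close>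
  have "distr M lborel X = distr M borel X"
    by (rule distr_cong) auto
  then show "distributed M lborel X (\<lambda>x. ennreal (indicator {a..b} x / measure lborel {a..b}))"
    using assms by (simp add: distributed_def uniform_measure_Icc_eq_density)
qed

lemma (in prob_space) AE_uniform_in_Icc:
  fixes a b :: real
  assumes X: "X \<in> borel_measurable M"
    and distr: "distr M borel X = uniform_measure lborel {a..b}"
  shows "AE w in M. X w \<in> {a..b}"
proof -
  have "AE x in distr M borel X. x \<in> {a..b}"
    unfolding distr by (rule AE_uniform_measureI) auto
  then show ?thesis
    using X by (subst (asm) AE_distr_iff) auto
qed

text \<open>The two events are disjoint, so their probabilities add up to that of the union.\<close>

lemma (in prob_space) AE_two_values:
  assumes X [measurable]: "X \<in> borel_measurable M" and "u \<noteq> v"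
    and "prob {w \<in> space M. X w = u} + prob {w \<in> space M. X w = (v::real)} = 1"
  shows "AE w in M. X w = u \<or> X w = v"
proof -
  have "prob {w \<in> space M. X w = u \<or> X w = v} = prob ({w \<in> space M. X w = u} \<union> {w \<in> space M. X w = v})"
    by (intro arg_cong[of _ _ prob]) auto
  also have "\<dots> = 1"
    using assms by (subst finite_measure_Union) auto
  finally show ?thesis
    by (subst (asm) prob_Collect_eq_1) auto
qed

section \<open>Almost sure bounds and energy levels in the ensemble\<close>

text \<open>The laws concern entries above the diagonal; symmetry and the zero diagonal give the
  remaining ones.\<close>

lemma (in spin_ensemble) AE_abs_J_le_1:
  "AE w in M. \<forall>i<N. \<forall>j<N. \<bar>J w $$ (i, j)\<bar> \<le> 1"
proof -
  have "AE w in M. \<bar>J w $$ (i, j)\<bar> \<le> 1" if "i < j" "j < N" for i j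
  proof -
    have "(\<lambda>w. J w $$ (i, j)) \<in> borel_measurable M"
      using J_indep that unfolding indep_vars_def by auto
    then have "AE w in M. J w $$ (i, j) = - 1 \<or> J w $$ (i, j) = 0"
      using J_minus[OF that] J_zero[OF that] by (intro AE_two_values) auto
    then show ?thesis
      by eventually_elim auto
  qed
  then have "AE w in M. \<forall>i<N. \<forall>j<N. i < j \<longrightarrow> \<bar>J w $$ (i, j)\<bar> \<le> 1"
    by (simp add: AE_all_countable)
  then show ?thesis
    using AE_space
  proof eventually_elim
    case (elim w)
    have "J w $$ (i, j) = J w $$ (j, i)" if "i < N" "j < N" for i j
      using arg_cong[OF J_symmetric[OF elim(2)], of "\<lambda>B. B $$ (j, i)"] J_carrier[OF elim(2)] that
      by auto
    then show ?case
      using elim(1) J_diag[OF elim(2)] by (metis abs_zero linorder_neqE_nat zero_le_one)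
  qed
qed

lemma (in spin_ensemble) AE_abs_\<sigma>_le_1:
  "AE w in M. \<forall>i<N. \<bar>\<sigma> w $ i\<bar> \<le> 1"
proof -
  have "AE w in M. \<bar>\<sigma> w $ i\<bar> \<le> 1" if "i < N" for i
  proof -
    have "(\<lambda>w. \<sigma> w $ i) \<in> borel_measurable M"
      using \<sigma>_indep that unfolding indep_vars_def by auto
    then have "AE w in M. \<sigma> w $ i = 1 \<or> \<sigma> w $ i = - 1"
      using \<sigma>_plus[OF that] \<sigma>_minus[OF that] by (intro AE_two_values) auto
    then show ?thesis
      by eventually_elim auto
  qed
  then show ?thesis
    by (simp add: AE_all_countable)
qed

lemma energy_eq_entries_coords:
  "energy N A s = - (1 / 2) * (\<Sum>i<N. \<Sum>j<N. entries N A (i, j) * coords N s i * coords N s j)"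
  by (simp add: energy_def entries_def coords_def)

text \<open>This displays the energy event as a preimage under the pair of \<open>entries\<close>
  and \<open>coords\<close>, the form in which independence from \<mu> is assumed. The energy reads
  only indices below \<open>N\<close>, so these restrictions preserve it.\<close>

lemma energy_level_set:
  "{w \<in> space M. energy N (J w) (\<sigma> w) = h} =
    (\<lambda>w. (entries N (J w), coords N (\<sigma> w))) -`
      {y \<in> space (entries_space N \<Otimes>\<^sub>M coords_space N).
        - (1 / 2) * (\<Sum>i<N. \<Sum>j<N. fst y (i, j) * snd y i * snd y j) = h} \<inter> space M"
  by (auto simp: energy_eq_entries_coords space_pair_measure space_PiM entries_def coords_def)

lemma energy_level_measurable:
  "{y \<in> space (entries_space N \<Otimes>\<^sub>M coords_space N).
      - (1 / 2) * (\<Sum>i<N. \<Sum>j<N. fst y (i, j) * snd y i * snd y j) = h}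
    \<in> sets (entries_space N \<Otimes>\<^sub>M coords_space N)"
proof -
  have "(\<lambda>y. - (1 / 2) * (\<Sum>i<N. \<Sum>j<N. fst y (i, j) * snd y i * snd y j))
      \<in> borel_measurable (entries_space N \<Otimes>\<^sub>M coords_space N)"
    by (intro borel_measurable_times borel_measurable_const borel_measurable_sum
        measurable_compose[OF measurable_fst measurable_component_singleton]
        measurable_compose[OF measurable_snd measurable_component_singleton]) auto
  then show ?thesis
    by measurable
qed

section \<open>Conditional expectation given the energy\<close>

theorem theorem2:
  fixes M :: "'w measure" and N :: nat and p1 a b h :: real
    and J :: "'w \<Rightarrow> real mat" and \<sigma> \<mu> :: "'w \<Rightarrow> real vec" and lam :: "'w \<Rightarrow> real"
  assumes N: "N \<ge> 2"
    and p1: "0 \<le> p1" "p1 \<le> 1"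
    and ab: "0 \<le> a" "a < b"
    and ensemble: "spin_ensemble M N p1 (1 / 2) J \<sigma>"
    and \<mu>_carrier: "\<And>w. w \<in> space M \<Longrightarrow> \<mu> w \<in> carrier_vec N"
    and \<mu>_indep: "prob_space.indep_vars M (\<lambda>_. borel) (\<lambda>i w. \<mu> w $ i) {..<N}"
    and \<mu>_uniform: "\<And>i. i < N \<Longrightarrow>
          distr M borel (\<lambda>w. \<mu> w $ i) = uniform_measure lborel {a..b}"
    and \<mu>_indep_J\<sigma>: "prob_space.independent M
          (coords_space N) (\<lambda>w. coords N (\<mu> w))
          (entries_space N \<Otimes>\<^sub>M coords_space N) (\<lambda>w. (entries N (J w), coords N (\<sigma> w)))"
    and lam: "drawn_from_spectrum M (generated_algebra M N J \<sigma> \<mu>) N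
          (\<lambda>w. hessian N (J w) (\<sigma> w) (\<mu> w)) lam"
    and h: "measure M {w \<in> space M. energy N (J w) (\<sigma> w) = h} > 0"
  shows "integrable (uniform_measure M {w \<in> space M. energy N (J w) (\<sigma> w) = h}) lam
       \<and> (\<integral>w. lam w \<partial>uniform_measure M {w \<in> space M. energy N (J w) (\<sigma> w) = h})
           = - (2 / real N) * h + (a + b)"
proof -
  interpret spin_ensemble M N p1 "1 / 2" J \<sigma>
    by fact
  define E where "E = {w \<in> space M. energy N (J w) (\<sigma> w) = h}"
  define F where "F = generated_algebra M N J \<sigma> \<mu>"
  define H where "H w = hessian N (J w) (\<sigma> w) (\<mu> w)" for w
  define B where "B = {y \<in> space (entries_space N \<Otimes>\<^sub>M coords_space N).
        - (1 / 2) * (\<Sum>i<N. \<Sum>j<N. fst y (i, j) * snd y i * snd y j) = h}"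
  have E_eq: "E = (\<lambda>w. (entries N (J w), coords N (\<sigma> w))) -` B \<inter> space M"
    unfolding E_def B_def by (rule energy_level_set)
  have B: "B \<in> sets (entries_space N \<Otimes>\<^sub>M coords_space N)"
    unfolding B_def by (rule energy_level_measurable)
  have J\<sigma>_meas: "(\<lambda>w. (entries N (J w), coords N (\<sigma> w))) \<in> M \<rightarrow>\<^sub>M entries_space N \<Otimes>\<^sub>M coords_space N"
    and \<mu>_meas: "(\<lambda>w. coords N (\<mu> w)) \<in> M \<rightarrow>\<^sub>M coords_space N"
    using \<mu>_indep_J\<sigma> by (auto simp: independent_def)
  have E: "E \<in> events"
    unfolding E_eq using measurable_sets[OF J\<sigma>_meas B] .
  have F_map: "(\<lambda>w. (entries N (J w), coords N (\<sigma> w), coords N (\<mu> w)))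
      \<in> M \<rightarrow>\<^sub>M entries_space N \<Otimes>\<^sub>M coords_space N \<Otimes>\<^sub>M coords_space N"
    using measurable_compose[OF J\<sigma>_meas measurable_fst] measurable_compose[OF J\<sigma>_meas measurable_snd] \<mu>_meas
    by (auto intro!: measurable_Pair)
  have sub: "subalgebra M F"
    unfolding subalgebra_def F_def generated_algebra_def
    using sets_image_in_sets[OF refl F_map] by simp
  \<comment> \<open>Membership in \<open>F\<close> allows \<open>lam\<close> to be replaced by its
    conditional expectation in the integral over \<open>E\<close>. The event constrains the first
    two components of the generating triple, whence the projection.\<close>
  have EF: "E \<in> sets F"
  proof -
    let ?T = "entries_space N \<Otimes>\<^sub>M coords_space N \<Otimes>\<^sub>M coords_space N"
    have "(\<lambda>(p, q, r). (p, q)) \<in> ?T \<rightarrow>\<^sub>M entries_space N \<Otimes>\<^sub>M coords_space N"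
      by measurable
    from measurable_sets[OF this B]
    have "(\<lambda>w. (entries N (J w), coords N (\<sigma> w), coords N (\<mu> w))) -`
        ((\<lambda>(p, q, r). (p, q)) -` B \<inter> space ?T) \<inter> space M \<in> sets F"
      unfolding F_def generated_algebra_def by (rule in_vimage_algebra)
    also have "(\<lambda>w. (entries N (J w), coords N (\<sigma> w), coords N (\<mu> w))) -`
        ((\<lambda>(p, q, r). (p, q)) -` B \<inter> space ?T) \<inter> space M = E"
      unfolding E_eq using measurable_space[OF F_map] by auto
    finally show ?thesis .
  qed
  interpret FA: finite_measure_subalgebra M F
    by unfold_locales (fact sub)

  have H_carrier: "H w \<in> carrier_mat N N" for w
    unfolding H_def by (rule hessian_carrier)
  have H_sym: "transpose_mat (H w) = H w" if "w \<in> space M" for w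
    unfolding H_def using that by (intro transpose_hessian J_carrier J_symmetric)
  have size: "size (eigenvalues (H w)) = N" if "w \<in> space M" for w
    by (rule size_eigenvalues_symmetric[OF H_carrier H_sym[OF that]])

  have \<mu>_i: "(\<lambda>w. \<mu> w $ i) \<in> borel_measurable M" if "i < N" for i
    using \<mu>_indep that unfolding indep_vars_def by auto
  \<comment> \<open>From \<open>0 \<le> a\<close> the interval lies in the nonnegative reals, so its
    right end bounds the modulus.\<close>
  have \<mu>_bound: "AE w in M. \<bar>\<mu> w $ i\<bar> \<le> b" if "i < N" for i
    using AE_uniform_in_Icc[OF \<mu>_i[OF that] \<mu>_uniform[OF that]]
    by eventually_elim (use ab in auto)
  have \<mu>_int: "integrable M (\<lambda>w. \<mu> w $ i)" if "i < N" for i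
    by (rule integrable_const_bound[of _ b]) (use \<mu>_bound[OF that] \<mu>_i[OF that] in auto)
  have "AE w in M. \<forall>i<N. \<bar>\<mu> w $ i\<bar> \<le> b"
    using \<mu>_bound by (simp add: AE_all_countable)
  \<comment> \<open>\<open>real N + 2 * b\<close> bounds the Hessian entries, and
    \<open>eigenvalue_bound\<close> contributes the outer factor \<open>real N\<close>.\<close>
  with AE_abs_J_le_1 AE_abs_\<sigma>_le_1
  have bound: "AE w in M. \<forall>e\<in>#eigenvalues (H w). \<bar>e\<bar> \<le> real N * (real N + 2 * b)"
  proof eventually_elim
    case (elim w)
    then show ?case
      unfolding H_def by (intro ballI eigenvalue_bound[OF hessian_carrier] hessian_entry_bound) auto
  qed

  have N0: "N > 0"
    using N by simp
  have lam': "drawn_from_spectrum M F N H lam"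
    using lam by (simp add: F_def H_def[abs_def])
  have lam_bound: "AE w in M. \<bar>lam w\<bar> \<le> real N * (real N + 2 * b)"
    by (rule drawn_from_spectrum_bounded[OF prob_space_axioms sub N0 lam' size bound])
  have lam_int: "integrable M lam"
    by (rule integrable_const_bound[OF _ lam'[unfolded drawn_from_spectrum_def, THEN conjunct1]])
       (use lam_bound in auto)

  have lam_cond_exp: "AE w in M. real_cond_exp M F lam w = (\<Sum>e\<in>#eigenvalues (H w). e) / real N"
    by (rule real_cond_exp_drawn_from_spectrum[OF prob_space_axioms sub N0 lam' size bound])

  \<comment> \<open>\<open>E\<close> is an event of the pair formed by \<open>J\<close> and
    \<sigma>, so independence leaves the mean of each \<open>\<mu> w $ i\<close> unchanged on
    it.\<close>
  have \<mu>_set_integral: "(\<integral>w\<in>E. \<mu> w $ i \<partial>M) = prob E * ((a + b) / 2)" if "i < N" for i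
  proof -
    have "(\<integral>w\<in>E. coords N (\<mu> w) i \<partial>M) = prob E * expectation (\<lambda>w. coords N (\<mu> w) i)"
      unfolding E_eq
      by (rule set_integral_independent[OF \<mu>_indep_J\<sigma> _ _ B])
         (use that \<mu>_int in \<open>auto simp: coords_def\<close>)
    with that expectation_uniform[OF ab(2) \<mu>_i[OF that] \<mu>_uniform[OF that]] show ?thesis
      by (simp add: coords_def)
  qed
  have \<mu>_set_int: "set_integrable M E (\<lambda>w. \<mu> w $ i)" if "i < N" for i
    unfolding set_integrable_def using E \<mu>_int[OF that] by (rule integrable_mult_indicator)
  have "(\<integral>w\<in>E. lam w \<partial>M) = (\<integral>w\<in>E. real_cond_exp M F lam w \<partial>M)"
    by (rule FA.real_cond_exp_intA[OF lam_int EF])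
  \<comment> \<open>The integrand is the trace of the Hessian divided by \<open>N\<close>, with the
    energy replaced by its constant value \<open>h\<close> on \<open>E\<close>.\<close>
  also have "\<dots> = (\<integral>w\<in>E. - (2 / real N) * h + (2 / real N) * (\<Sum>i<N. \<mu> w $ i) \<partial>M)"
  proof (rule set_lebesgue_integral_cong_AE)
    show "AE w\<in>E in M. real_cond_exp M F lam w = - (2 / real N) * h + (2 / real N) * (\<Sum>i<N. \<mu> w $ i)"
      using lam_cond_exp AE_space
    proof eventually_elim
      case (elim w)
      have "(\<Sum>e\<in>#eigenvalues (H w). e) = - 2 * energy N (J w) (\<sigma> w) + 2 * (\<Sum>i<N. \<mu> w $ i)"
        using sum_eigenvalues_symmetric[OF H_carrier H_sym[OF elim(2)]]
        by (simp add: H_def trace_hessian)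
      with elim show ?case
        by (auto simp: E_def add_divide_distrib diff_divide_distrib)
    qed
  qed (use E \<mu>_i in auto)
  also have "\<dots> = (\<integral>w\<in>E. - (2 / real N) * h \<partial>M) + (2 / real N) * (\<Sum>i<N. \<integral>w\<in>E. \<mu> w $ i \<partial>M)"
  proof -
    have sum_int: "set_integrable M E (\<lambda>w. \<Sum>i<N. \<mu> w $ i)"
      using \<mu>_set_int unfolding set_integrable_def scaleR_sum_right
      by (intro Bochner_Integration.integrable_sum) auto
    have "set_integrable M E (\<lambda>w. - (2 / real N) * h)"
      unfolding set_integrable_def by (intro integrable_mult_indicator E) simp
    moreover have "(\<integral>w\<in>E. (\<Sum>i<N. \<mu> w $ i) \<partial>M) = (\<Sum>i<N. \<integral>w\<in>E. \<mu> w $ i \<partial>M)"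
      using \<mu>_set_int unfolding set_lebesgue_integral_def set_integrable_def scaleR_sum_right
      by (intro Bochner_Integration.integral_sum) auto
    ultimately show ?thesis
      using sum_int by (subst set_integral_add) auto
  qed
  also have "\<dots> = prob E * (- (2 / real N) * h + (a + b))"
  proof -
    have "(\<integral>w\<in>E. - (2 / real N) * h \<partial>M) = prob E * (- (2 / real N) * h)"
      using E by (simp add: set_lebesgue_integral_def)
    \<comment> \<open>The \<open>N\<close> summands all equal \<open>prob E * ((a + b) / 2)\<close>,
      which cancels the factor \<open>2 / real N\<close>.\<close>
    moreover have "(2 / real N) * (\<Sum>i<N. \<integral>w\<in>E. \<mu> w $ i \<partial>M) = prob E * (a + b)"
      using N0 by (simp add: \<mu>_set_integral)
    ultimately show ?thesis
      by (simp only: distrib_left)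
  qed
  finally have "(\<integral>w\<in>E. lam w \<partial>M) / prob E = - (2 / real N) * h + (a + b)"
    using h by (simp add: E_def)
  then show ?thesis
    using integrable_uniform_measure[OF E _ lam_int] integral_uniform_measure[OF E _ lam_int] h
    by (simp add: E_def)
qed

end
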